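(* Let $D=\{1,\ldots,d\}$, let $\bm{X}_P=(X_{P,1},\ldots,X_{P,d})$ be a random vector with standard Pareto margins, let $\bm{X}_E=\log\bm{X}_P$ (componentwise), which has standard exponential margins, and let $\bm{X}_E^1,\bm{X}_E^2,\ldots$ be independent copies of $\bm{X}_E$. Suppose that the sample cloud $N_n=\{\bm{X}_E^1/\log n,\ldots,\bm{X}_E^n/\log n\}$ converges in probability onto a limit set $G=\{\bm{x}\in\mathbb{R}^d_+:g(\bm{x})\le1\}$ with continuous gauge function $g$. Let $\delta\in[0,1]$ and let $C\subseteq D$ be non-empty, and assume that, as a function of $t$, $$\mathbb{P}\Big(\min_{i\in C}X_{P,i}>xt,\ \max_{j\in D\setminus C}X_{P,j}\le yt^\delta\Big)\in\mathrm{RV}^\infty_{-1/\tau_C(\delta)},\qquad x,y>0,$$ with $\tau_C(\delta)\in(0,1]$. Let $B_{C,\delta}=B^1_{C,\delta}\cup B^\delta_{C,\delta}$, where $$B^1_{C,\delta}=\bigcup_{i\in C}\{\bm{x}\in\mathbb{R}^d_+:x_i=1,\ x_j\ge1\ \forall j\in C\setminus\{i\},\ x_k\le\delta\ \forall k\in D\setminus C\},$$ $$B^\delta_{C,\delta}=\bigcup_{i\in D\setminus C}\{\bm{x}\in\mathbb{R}^d_+:x_i=\delta,\ x_j\le\delta\ \forall j\in(D\setminus C)\setminus\{i\},\ x_k\ge1\ \forall k\in C\}.$$ Then $$\tau_C(\delta)=\Big[\min_{\bm{y}\in B_{C,\delta}}g(\bm{y})\Big]^{-1}=\Big[\min_{\bm{y}\in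 B^1_{C,\delta}}g(\bm{y})\Big]^{-1}.$$
   Context: $f\in\mathrm{RV}^\infty_\rho$ means $f(tx)/f(t)\to x^\rho$ as $t\to\infty$ for every $x>0$. $\mathbb{R}^d_+=[0,\infty)^d$. For $C=D$ the condition on $\max_{j\in D\setminus C}$ is void, the coefficient is denoted $\tau_D$ (not depending on $\delta$), $B^\delta_{D,\delta}=\emptyset$ and $B_{D,\delta}=B_D=\{\bm{x}:\min(\bm{x})=1\}$. A sequence of random non-empty compact sets $N_n\subset\mathbb{R}^d$ converges in probability onto a deterministic non-empty compact set $G$ (the limit set) if $d_H(N_n,G)\to0$ in probability, where $d_H$ is the Hausdorff distance. The gauge function of $G$ is $g(\bm{x})=\inf\{t\ge0:\bm{x}\in tG\}$ for $\bm{x}\in\mathbb{R}^d_+$; it satisfies $g(t\bm{x})=tg(\bm{x})$ for $t>0$. *)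

theory Defs
  imports "HOL-Probability.Probability"
begin

definition nonneg_orthant :: "(real ^ 'd) set" where
  "nonneg_orthant = {x. \<forall>i. 0 \<le> x $ i}"

definition log_vec :: "real ^ 'd \<Rightarrow> real ^ 'd" where
  "log_vec x = (\<chi> i. ln (x $ i))"

definition standard_pareto :: "'a measure \<Rightarrow> ('a \<Rightarrow> real) \<Rightarrow> bool" where
  "standard_pareto M Z \<longleftrightarrow>
     Z \<in> borel_measurable M \<and> (\<forall>x\<ge>1. measure M {\<omega> \<in> space M. Z \<omega> > x} = 1 / x)"

definition regularly_varying :: "(real \<Rightarrow> real) \<Rightarrow> real \<Rightarrow> bool" where
  "regularly_varying f \<rho> \<longleftrightarrow> (\<forall>x>0. ((\<lambda>t. f (t * x) / f t) \<longlongrightarrow> x powr \<rho>) at_top)"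

(* Meaningful for non-empty bounded sets, on which both suprema are over
   non-empty bounded sets of reals. *)
definition hausdorff_dist :: "'a::metric_space set \<Rightarrow> 'a set \<Rightarrow> real" where
  "hausdorff_dist A B = max (SUP a\<in>A. infdist a B) (SUP b\<in>B. infdist b A)"

definition converges_in_prob_onto ::
    "'a measure \<Rightarrow> (nat \<Rightarrow> 'a \<Rightarrow> 'b::metric_space set) \<Rightarrow> 'b set \<Rightarrow> bool" where
  "converges_in_prob_onto M N G \<longleftrightarrow>
     compact G \<and> G \<noteq> {} \<and>
     (\<forall>\<epsilon>>0. (\<lambda>n. measure M {\<omega> \<in> space M. hausdorff_dist (N n \<omega>) G > \<epsilon>}) \<longlonglongrightarrow> 0)"

(* The copies are indexed from 0, so the n-th cloud uses the copies 0, ..., n - 1.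
   Only n \<ge> 2 is meaningful, since ln n = 0 for n = 1. *)
definition sample_cloud :: "(nat \<Rightarrow> 'a \<Rightarrow> real ^ 'd) \<Rightarrow> nat \<Rightarrow> 'a \<Rightarrow> (real ^ 'd) set" where
  "sample_cloud X n \<omega> = (\<lambda>k. (1 / ln (real n)) *\<^sub>R X k \<omega>) ` {..<n}"

(* Extended-real valued, so that the infimum of the empty set is \<infinity>. *)
definition gauge_function :: "(real ^ 'd) set \<Rightarrow> real ^ 'd \<Rightarrow> ereal" where
  "gauge_function G x = Inf {ereal t |t. 0 \<le> t \<and> x \<in> (\<lambda>z. t *\<^sub>R z) ` G}"

definition B1 :: "'d set \<Rightarrow> real \<Rightarrow> (real ^ 'd) set" where
  "B1 C \<delta> = (\<Union>i\<in>C. {x \<in> nonneg_orthant.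
      x $ i = 1 \<and> (\<forall>j\<in>C - {i}. x $ j \<ge> 1) \<and> (\<forall>k\<in>UNIV - C. x $ k \<le> \<delta>)})"

definition Bdelta :: "'d set \<Rightarrow> real \<Rightarrow> (real ^ 'd) set" where
  "Bdelta C \<delta> = (\<Union>i\<in>UNIV - C. {x \<in> nonneg_orthant.
      x $ i = \<delta> \<and> (\<forall>j\<in>(UNIV - C) - {i}. x $ j \<le> \<delta>) \<and> (\<forall>k\<in>C. x $ k \<ge> 1)})"

definition B :: "'d set \<Rightarrow> real \<Rightarrow> (real ^ 'd) set" where
  "B C \<delta> = B1 C \<delta> \<union> Bdelta C \<delta>"

(* Min over C and max over its complement are spelled out pointwise, which makes
   the condition on the complement void when C is the whole index set. *)
definition joint_tail_prob ::
    "'a measure \<Rightarrow> ('a \<Rightarrow> real ^ 'd) \<Rightarrow> 'd set \<Rightarrow> real \<Rightarrow> real \<Rightarrow> real \<Rightarrow> real \<Rightarrow> real" where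
  "joint_tail_prob M X C \<delta> x y t =
     measure M {\<omega> \<in> space M.
       (\<forall>i\<in>C. X \<omega> $ i > x * t) \<and> (\<forall>j\<in>UNIV - C. X \<omega> $ j \<le> y * t powr \<delta>)}"

end

theory Submission
  imports Defs
begin

text \<open>
  If the cloud converges onto \<open>G\<close>, then a closed set disjoint from \<open>G\<close> has a bounded expected
  number of the \<open>n\<close> scaled points, while for an open set meeting \<open>G\<close> this number stays away
  from 0. Let \<open>h\<close> be the gauge and \<open>m\<close> its minimum over \<open>x\<^sub>C \<ge> 1\<close>, \<open>x\<^sub>D\<^sub>-\<^sub>C \<le> \<delta>\<close>, which by
  homogeneity is attained on \<open>B1 C \<delta>\<close>. The region stretched by \<open>\<theta>\<close> misses \<open>G\<close> when \<open>\<theta> m > 1\<close> and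
  its interior meets \<open>G\<close> when \<open>\<theta> m < 1\<close>. Its expected count is \<open>n f(n\<^sup>\<theta>)\<close>, where \<open>f\<close> is the joint
  tail probability, and along \<open>n = 2\<^sup>k\<close> successive counts have ratio tending to
  \<open>2 powr (1 - \<theta> / \<tau>)\<close>. So \<open>\<tau> \<le> \<theta>\<close> in the first case and \<open>\<tau> \<ge> \<theta>\<close> in the second.
\<close>

section \<open>Limits of successive ratios, and regular variation along geometric sequences\<close>

lemma ratio_tendsto_imp_null:
  fixes c :: "nat \<Rightarrow> real"
  assumes lim: "(\<lambda>n. c (Suc n) / c n) \<longlonglongrightarrow> L" and L: "0 < L" "L < 1"
  shows "c \<longlonglongrightarrow> 0"
proof -
  obtain r where r: "L < r" "r < 1"
    using dense[OF \<open>L < 1\<close>] by auto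
  have "\<forall>\<^sub>F n in sequentially. 0 < c (Suc n) / c n \<and> c (Suc n) / c n < r"
    using order_tendstoD[OF lim] L r by (intro eventually_conj) auto
  then obtain N where N: "\<And>n. n \<ge> N \<Longrightarrow> 0 < c (Suc n) / c n \<and> c (Suc n) / c n < r"
    by (auto simp: eventually_sequentially)
  have "norm (c (Suc n)) \<le> r * norm (c n)" if "n \<ge> N" for n
  proof -
    \<comment> \<open>Since \<open>x / 0 = 0\<close>, a positive ratio forces \<open>c n\<close> to
      be non-zero, which is why \<open>L\<close> must be positive.\<close>
    from N[OF that] have "\<bar>c (Suc n)\<bar> / \<bar>c n\<bar> < r" "c n \<noteq> 0"
      by (auto simp flip: abs_divide)
    then show ?thesis by (simp add: field_simps)
  qed
  then have "summable c"
    using r by (intro summable_ratio_test[of r N c]) auto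
  then show ?thesis by (rule summable_LIMSEQ_zero)
qed

lemma ratio_limit_ge_1:
  fixes c :: "nat \<Rightarrow> real"
  assumes lim: "(\<lambda>n. c (Suc n) / c n) \<longlonglongrightarrow> L" and "0 < L"
    and "0 < K" and ev: "\<forall>\<^sub>F n in sequentially. K \<le> c n"
  shows "1 \<le> L"
proof (rule ccontr)
  assume "\<not> 1 \<le> L"
  then have "c \<longlonglongrightarrow> 0"
    using ratio_tendsto_imp_null[OF lim] \<open>0 < L\<close> by simp
  then have "\<forall>\<^sub>F n in sequentially. c n < K"
    using order_tendstoD(2) \<open>0 < K\<close> by blast
  with ev have "\<forall>\<^sub>F n in sequentially. False"
    by eventually_elim simp
  then show False by simp
qed

text \<open>The reciprocals of \<open>c\<close> have ratio limit \<open>inverse L\<close> and are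
  bounded below by \<open>inverse K\<close>, so the previous lemma applies to them. Because
  \<open>inverse 0 = 0\<close>, that lower bound needs \<open>c n > 0\<close>, which eventually
  follows from the positive ratio limit and non-negativity.\<close>

lemma ratio_limit_le_1:
  fixes c :: "nat \<Rightarrow> real"
  assumes lim: "(\<lambda>n. c (Suc n) / c n) \<longlonglongrightarrow> L" and "0 < L"
    and nonneg: "\<And>n. 0 \<le> c n" and "0 < K" and ev: "\<forall>\<^sub>F n in sequentially. c n \<le> K"
  shows "L \<le> 1"
proof -
  have "(\<lambda>n. inverse (c (Suc n) / c n)) \<longlonglongrightarrow> inverse L"
    using lim \<open>0 < L\<close> by (intro tendsto_inverse) auto
  then have "(\<lambda>n. inverse (c (Suc n)) / inverse (c n)) \<longlonglongrightarrow> inverse L"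
    by (simp add: field_simps)
  moreover have "\<forall>\<^sub>F n in sequentially. inverse K \<le> inverse (c n)"
    using ev order_tendstoD(1)[OF lim \<open>0 < L\<close>]
  proof eventually_elim
    case (elim n)
    then have "c n \<noteq> 0" by auto
    with nonneg[of n] have "0 < c n" by simp
    then show ?case using elim by (intro le_imp_inverse_le) auto
  qed
  ultimately have "1 \<le> inverse L"
    using \<open>0 < K\<close> \<open>0 < L\<close> by (intro ratio_limit_ge_1[of "\<lambda>n. inverse (c n)" _ "inverse K"]) auto
  then show ?thesis
    using \<open>0 < L\<close> by (simp add: field_simps)
qed

text \<open>At \<open>t = a ^ m\<close> the fixed factor \<open>a\<close> leads to the next term of
  the sequence, so regular variation at the single point \<open>a\<close> gives the ratio limit. The
  weight \<open>b\<close> will account for the growth of the sample size.\<close>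

lemma regularly_varying_geometric:
  assumes rv: "regularly_varying f \<rho>" and "1 < a" and "b \<noteq> 0"
  shows "(\<lambda>m. (b ^ Suc m * f (a ^ Suc m)) / (b ^ m * f (a ^ m))) \<longlonglongrightarrow> b * a powr \<rho>"
proof -
  have "((\<lambda>t. f (t * a) / f t) \<longlongrightarrow> a powr \<rho>) at_top"
    using rv \<open>1 < a\<close> unfolding regularly_varying_def by auto
  moreover have "filterlim (\<lambda>m. a ^ m) at_top sequentially"
    using \<open>1 < a\<close> by (intro filterlim_at_infinity_imp_filterlim_at_top
        filterlim_realpow_sequentially_gt1 always_eventually) auto
  ultimately have "(\<lambda>m. f (a ^ m * a) / f (a ^ m)) \<longlonglongrightarrow> a powr \<rho>"
    by (rule filterlim_compose)
  then have "(\<lambda>m. b * (f (a ^ m * a) / f (a ^ m))) \<longlonglongrightarrow> b * a powr \<rho>"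
    by (rule tendsto_mult_left)
  then show ?thesis
    using \<open>b \<noteq> 0\<close> by (simp add: ac_simps)
qed

section \<open>Hausdorff distance between a sample cloud and a compact set\<close>

text \<open>Compactness bounds the continuous distance functions, so the suprema of reals in
  \<open>hausdorff_dist\<close> are genuine upper bounds.\<close>

lemma infdist_le_hausdorff_dist:
  assumes "compact A" "compact H" "A \<noteq> {}" "H \<noteq> {}"
  shows "a \<in> A \<Longrightarrow> infdist a H \<le> hausdorff_dist A H"
    and "b \<in> H \<Longrightarrow> infdist b A \<le> hausdorff_dist A H"
proof -
  have bdd: "bdd_above ((\<lambda>x. infdist x T) ` S)" if "compact S" for S T :: "'a set"
    by (intro bounded_imp_bdd_above compact_imp_bounded compact_continuous_image
          continuous_on_infdist continuous_on_id that)
  show "a \<in> A \<Longrightarrow> infdist a H \<le> hausdorff_dist A H"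
    unfolding hausdorff_dist_def using cSUP_upper[OF _ bdd[OF assms(1)], of a H] by simp
  show "b \<in> H \<Longrightarrow> infdist b A \<le> hausdorff_dist A H"
    unfolding hausdorff_dist_def using cSUP_upper[OF _ bdd[OF assms(2)], of b A] by simp
qed

lemma less_hausdorff_dist_iff:
  assumes "compact A" "compact H" "A \<noteq> {}" "H \<noteq> {}"
  shows "e < hausdorff_dist A H \<longleftrightarrow> (\<exists>a\<in>A. e < infdist a H) \<or> (\<exists>b\<in>H. e < infdist b A)"
proof -
  have bdd: "bdd_above ((\<lambda>x. infdist x T) ` S)" if "compact S" for S T :: "'a set"
    by (intro bounded_imp_bdd_above compact_imp_bounded compact_continuous_image
          continuous_on_infdist continuous_on_id that)
  show ?thesis
    unfolding hausdorff_dist_def less_max_iff_disj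
    using less_cSUP_iff[OF assms(3) bdd[OF assms(1)]] less_cSUP_iff[OF assms(4) bdd[OF assms(2)]]
    by auto
qed

text \<open>The infimum over a finite set is attained, so the inequality stays strict.\<close>

lemma finite_less_infdist_iff:
  fixes A :: "'a::heine_borel set"
  assumes "finite A" "A \<noteq> {}"
  shows "e < infdist b A \<longleftrightarrow> (\<forall>a\<in>A. e < dist b a)"
proof
  assume "e < infdist b A"
  then show "\<forall>a\<in>A. e < dist b a"
    using infdist_le[of _ A b] by (auto intro: less_le_trans)
next
  assume "\<forall>a\<in>A. e < dist b a"
  moreover obtain a where "a \<in> A" "infdist b A = dist b a"
    using infdist_attains_inf[of A b] assms finite_imp_closed by blast
  ultimately show "e < infdist b A" by auto
qed

lemma sample_cloud_compact: "compact (sample_cloud X n \<omega>)"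
  by (simp add: sample_cloud_def finite_imp_compact)

lemma sample_cloud_nonempty: "0 < n \<Longrightarrow> sample_cloud X n \<omega> \<noteq> {}"
  by (auto simp: sample_cloud_def)

text \<open>Without measurability the probability in the convergence hypothesis would be the junk
  value 0. The supremum over the limit set is reduced to a countable dense subset.\<close>

lemma hausdorff_dist_sample_cloud_sets:
  fixes G :: "(real ^ 'd) set"
  assumes X: "\<And>k. X k \<in> borel_measurable M"
    and G: "compact G" "G \<noteq> {}" and "0 < n"
  shows "{\<omega> \<in> space M. e < hausdorff_dist (sample_cloud X n \<omega>) G} \<in> sets M"
proof -
  obtain T where T: "countable T" "T \<subseteq> G" "G \<subseteq> closure T"
    using separable by blast
  let ?N = "sample_cloud X n"
  let ?Y = "\<lambda>k \<omega>. (1 / ln (real n)) *\<^sub>R X k \<omega>"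
  have fin: "finite (?N \<omega>)" for \<omega>
    by (simp add: sample_cloud_def)
  \<comment> \<open>The set of \<open>x\<close> with \<open>e < infdist x S\<close> is open, so if
    it contains a point of \<open>G\<close> it also contains one of the dense set
    \<open>T\<close>.\<close>
  have dense: "(\<exists>b\<in>G. e < infdist b S) \<longleftrightarrow> (\<exists>b\<in>T. e < infdist b S)" for S
  proof
    assume "\<exists>b\<in>G. e < infdist b S"
    then obtain b where b: "b \<in> G" "e < infdist b S" by auto
    have "open {x. e < infdist x S}"
      by (intro open_Collect_less continuous_on_const continuous_on_infdist continuous_on_id)
    with b T(3) show "\<exists>b\<in>T. e < infdist b S"
      using open_Int_closure_eq_empty[of "{x. e < infdist x S}" T] by auto
  qed (use T in auto)
  have "e < hausdorff_dist (?N \<omega>) G \<longleftrightarrow>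
      (\<exists>k<n. e < infdist (?Y k \<omega>) G) \<or> (\<exists>b\<in>T. \<forall>k<n. e < dist b (?Y k \<omega>))" for \<omega>
  proof -
    have "e < infdist b (?N \<omega>) \<longleftrightarrow> (\<forall>k<n. e < dist b (?Y k \<omega>))" for b
      unfolding finite_less_infdist_iff[OF fin sample_cloud_nonempty[OF \<open>0 < n\<close>]]
      by (auto simp: sample_cloud_def)
    then show ?thesis
      unfolding less_hausdorff_dist_iff[OF sample_cloud_compact G(1)
          sample_cloud_nonempty[OF \<open>0 < n\<close>] G(2)] dense
      by (auto simp: sample_cloud_def)
  qed
  moreover have "{\<omega> \<in> space M. (\<exists>k<n. e < infdist (?Y k \<omega>) G) \<or>
      (\<exists>b\<in>T. \<forall>k<n. e < dist b (?Y k \<omega>))} \<in> sets M"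
  proof -
    have Y: "?Y k \<in> borel_measurable M" for k
      by (intro borel_measurable_scaleR borel_measurable_const X)
    have "(\<lambda>x. infdist x G) \<in> borel_measurable borel"
      by (intro borel_measurable_continuous_onI continuous_on_infdist continuous_on_id)
    then have inf: "(\<lambda>\<omega>. infdist (?Y k \<omega>) G) \<in> borel_measurable M" for k
      using measurable_compose[OF Y] by blast
    have cloud_far: "{\<omega> \<in> space M. \<exists>k\<in>{..<n}. e < infdist (?Y k \<omega>) G} \<in> sets M"
      by (intro sets.sets_Collect_countable_Bex borel_measurable_less borel_measurable_const inf)
    have "{\<omega> \<in> space M. \<forall>k\<in>{..<n}. e < dist b (?Y k \<omega>)} \<in> sets M" for b
      by (intro sets.sets_Collect_countable_Ball borel_measurable_less borel_measurable_const
          borel_measurable_dist Y)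
    then have "(\<Union>b\<in>T. {\<omega> \<in> space M. \<forall>k\<in>{..<n}. e < dist b (?Y k \<omega>)}) \<in> sets M"
      using T(1) by (intro sets.countable_UN') auto
    also have "(\<Union>b\<in>T. {\<omega> \<in> space M. \<forall>k\<in>{..<n}. e < dist b (?Y k \<omega>)}) =
        {\<omega> \<in> space M. \<exists>b\<in>T. \<forall>k\<in>{..<n}. e < dist b (?Y k \<omega>)}"
      by blast
    finally have limit_far:
      "{\<omega> \<in> space M. \<exists>b\<in>T. \<forall>k\<in>{..<n}. e < dist b (?Y k \<omega>)} \<in> sets M" .
    show ?thesis
      using sets.sets_Collect_disj[OF limit_far cloud_far]
      by (simp only: lessThan_iff Ball_def Bex_def)
  qed
  ultimately show ?thesis by (simp only:)
qed

section \<open>Expected numbers of scaled sample points in closed and open sets\<close>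

lemma (in prob_space) prob_iid_all_in:
  assumes indep: "indep_vars (\<lambda>_. borel) X UNIV"
    and law: "\<And>k::nat. distr M borel (X k) = Q"
    and S: "S \<in> sets borel" and "0 < n"
  shows "prob {\<omega> \<in> space M. \<forall>k<n. X k \<omega> \<in> S} = measure Q S ^ n"
proof -
  have X: "X k \<in> borel_measurable M" for k
    using indep by (auto simp: indep_vars_def2)
  have marginal: "prob (X k -` S \<inter> space M) = measure Q S" for k
    using measure_distr[OF X S, of k] law by simp
  have "prob (\<Inter>k\<in>{..<n}. X k -` S \<inter> space M) = (\<Prod>k\<in>{..<n}. prob (X k -` S \<inter> space M))"
    using \<open>0 < n\<close> S by (intro indep_varsD[OF indep]) auto
  also have "\<dots> = measure Q S ^ n"
    by (simp add: marginal)
  also have "(\<Inter>k\<in>{..<n}. X k -` S \<inter> space M) = {\<omega> \<in> space M. \<forall>k<n. X k \<omega> \<in> S}"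
    using \<open>0 < n\<close> by auto
  finally show ?thesis by simp
qed

text \<open>A scaled point in \<open>K\<close> keeps a positive distance \<open>d\<close> from the
  compact set \<open>G\<close>, so it makes the Hausdorff distance exceed \<open>d / 2\<close>. With
  \<open>p\<close> the probability of hitting \<open>K\<close>, the probability
  \<open>(1 - p) ^ n\<close> of no hit therefore tends to 1, whereas it is at most
  \<open>exp (- n * p)\<close>.\<close>

lemma (in prob_space) sample_cloud_expected_count_le:
  fixes X :: "nat \<Rightarrow> 'a \<Rightarrow> real ^ 'd"
  assumes indep: "indep_vars (\<lambda>_. borel) X UNIV"
    and law: "\<And>k. distr M borel (X k) = Q"
    and conv: "converges_in_prob_onto M (sample_cloud X) G"
    and K: "closed K" "K \<inter> G = {}"
  shows "\<forall>\<^sub>F n in sequentially. real n * measure Q {x. (1 / ln (real n)) *\<^sub>R x \<in> K} \<le> 1"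
proof -
  have X: "X k \<in> borel_measurable M" for k
    using indep by (auto simp: indep_vars_def2)
  interpret Q: prob_space Q
    using prob_space_distr[OF X] law by metis
  have Q: "sets Q = sets borel" "space Q = UNIV"
    using law by (metis sets_distr, metis space_distr space_borel)
  have G: "compact G" "G \<noteq> {}"
    and lim: "\<And>e. e > 0 \<Longrightarrow>
      (\<lambda>n. prob {\<omega> \<in> space M. e < hausdorff_dist (sample_cloud X n \<omega>) G}) \<longlonglongrightarrow> 0"
    using conv by (auto simp: converges_in_prob_onto_def)
  obtain d where d: "d > 0" "\<And>x y. x \<in> G \<Longrightarrow> y \<in> K \<Longrightarrow> d \<le> dist x y"
    using separate_compact_closed[OF G(1) K(1)] K(2) by blast
  \<comment> \<open>This threshold leaves probability at least \<open>exp (-1)\<close> for no hit;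
    comparison with \<open>exp (- n * p)\<close> then gives exactly the bound 1.\<close>
  have "0 < 1 - exp (-1::real)" by simp
  then have "\<forall>\<^sub>F n in sequentially.
      prob {\<omega> \<in> space M. d / 2 < hausdorff_dist (sample_cloud X n \<omega>) G} < 1 - exp (-1::real)"
    using d(1) by (intro order_tendstoD(2)[OF lim]) simp
  then show ?thesis
    using eventually_gt_at_top[of 0]
  proof eventually_elim
    case (elim n)
    let ?H = "{\<omega> \<in> space M. d / 2 < hausdorff_dist (sample_cloud X n \<omega>) G}"
    let ?S = "{x. (1 / ln (real n)) *\<^sub>R x \<in> K}"
    let ?E = "{\<omega> \<in> space M. \<forall>k<n. X k \<omega> \<in> - ?S}"
    have H: "?H \<in> sets M"
      using hausdorff_dist_sample_cloud_sets[OF X G elim(2)] .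
    have S: "?S \<in> sets borel"
      using K(1) by (intro borel_closed) (auto intro!: closed_vimage[unfolded vimage_def] continuous_intros)
    have E: "?E \<in> sets M"
      using X S by measurable
    have "space M - ?E \<subseteq> ?H"
    proof
      fix \<omega> assume "\<omega> \<in> space M - ?E"
      then obtain k where k: "\<omega> \<in> space M" "k < n" "(1 / ln (real n)) *\<^sub>R X k \<omega> \<in> K" by auto
      let ?y = "(1 / ln (real n)) *\<^sub>R X k \<omega>"
      have "d \<le> infdist ?y G"
        unfolding infdist_notempty[OF G(2)]
        using d(2) k(3) G(2) by (intro cINF_greatest) (auto simp: dist_commute)
      also have "\<dots> \<le> hausdorff_dist (sample_cloud X n \<omega>) G"
        using k(2) elim(2) G
        by (intro infdist_le_hausdorff_dist sample_cloud_compact sample_cloud_nonempty)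
          (auto simp: sample_cloud_def)
      finally show "\<omega> \<in> ?H" using k(1) d(1) by auto
    qed
    then have "prob (space M - ?E) \<le> prob ?H"
      by (intro finite_measure_mono H)
    then have "1 - prob ?E \<le> prob ?H"
      unfolding prob_compl[OF E] .
    then have "exp (-1) \<le> prob ?E"
      using elim by simp
    also have "prob ?E = measure Q (- ?S) ^ n"
      using S elim(2) by (intro prob_iid_all_in[OF indep law]) auto
    also have "measure Q (- ?S) = 1 - measure Q ?S"
      using Q.prob_compl[of ?S] S Q by (simp add: Compl_eq_Diff_UNIV)
    also have "(1 - measure Q ?S) ^ n \<le> exp (- measure Q ?S) ^ n"
      using Q.prob_le_1[of ?S] exp_ge_add_one_self[of "- measure Q ?S"] by (intro power_mono) auto
    also have "\<dots> = exp (- (real n * measure Q ?S))"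
      by (simp flip: exp_of_nat_mult)
    finally show ?case by simp
  qed
qed

text \<open>If no scaled point falls into \<open>U\<close>, the whole cloud stays at least
  \<open>r\<close> away from \<open>z\<close>, an event of vanishing probability. Once
  \<open>(1 - p) ^ n < 1 / 2\<close>, Bernoulli's inequality
  \<open>1 - n * p \<le> (1 - p) ^ n\<close> gives the bound.\<close>

lemma (in prob_space) sample_cloud_expected_count_ge:
  fixes X :: "nat \<Rightarrow> 'a \<Rightarrow> real ^ 'd"
  assumes indep: "indep_vars (\<lambda>_. borel) X UNIV"
    and law: "\<And>k. distr M borel (X k) = Q"
    and conv: "converges_in_prob_onto M (sample_cloud X) G"
    and U: "open U" "z \<in> U" "z \<in> G"
  shows "\<forall>\<^sub>F n in sequentially. 1 / 2 \<le> real n * measure Q {x. (1 / ln (real n)) *\<^sub>R x \<in> U}"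
proof -
  have X: "X k \<in> borel_measurable M" for k
    using indep by (auto simp: indep_vars_def2)
  interpret Q: prob_space Q
    using prob_space_distr[OF X] law by metis
  have Q: "sets Q = sets borel" "space Q = UNIV"
    using law by (metis sets_distr, metis space_distr space_borel)
  have G: "compact G" "G \<noteq> {}"
    and lim: "\<And>e. e > 0 \<Longrightarrow>
      (\<lambda>n. prob {\<omega> \<in> space M. e < hausdorff_dist (sample_cloud X n \<omega>) G}) \<longlonglongrightarrow> 0"
    using conv by (auto simp: converges_in_prob_onto_def)
  obtain r where r: "r > 0" "\<And>y. dist z y < r \<Longrightarrow> y \<in> U"
    using U by (auto simp: open_contains_ball subset_iff)
  have "0 < (1 / 2::real)" by simp
  then have "\<forall>\<^sub>F n in sequentially.
      prob {\<omega> \<in> space M. r / 2 < hausdorff_dist (sample_cloud X n \<omega>) G} < (1 / 2::real)"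
    using r(1) by (intro order_tendstoD(2)[OF lim]) simp
  then show ?thesis
    using eventually_gt_at_top[of 0]
  proof eventually_elim
    case (elim n)
    let ?H = "{\<omega> \<in> space M. r / 2 < hausdorff_dist (sample_cloud X n \<omega>) G}"
    let ?S = "{x. (1 / ln (real n)) *\<^sub>R x \<in> U}"
    let ?E = "{\<omega> \<in> space M. \<forall>k<n. X k \<omega> \<in> - ?S}"
    have H: "?H \<in> sets M"
      using hausdorff_dist_sample_cloud_sets[OF X G elim(2)] .
    have S: "?S \<in> sets borel"
      using U(1) by (intro borel_open) (auto intro!: open_vimage[unfolded vimage_def] continuous_intros)
    have "?E \<subseteq> ?H"
    proof
      fix \<omega> assume \<omega>: "\<omega> \<in> ?E"
      have "r / 2 < infdist z (sample_cloud X n \<omega>)"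
      proof (subst finite_less_infdist_iff)
        show "\<forall>a\<in>sample_cloud X n \<omega>. r / 2 < dist z a"
        proof
          fix a assume "a \<in> sample_cloud X n \<omega>"
          then have "a \<notin> U" using \<omega> by (auto simp: sample_cloud_def)
          then have "r \<le> dist z a" using r(2) by (meson not_le)
          then show "r / 2 < dist z a" using r(1) by simp
        qed
      qed (use elim(2) in \<open>auto simp: sample_cloud_def\<close>)
      also have "\<dots> \<le> hausdorff_dist (sample_cloud X n \<omega>) G"
        using elim(2) G U(3)
        by (intro infdist_le_hausdorff_dist sample_cloud_compact sample_cloud_nonempty) auto
      finally show "\<omega> \<in> ?H" using \<omega> by auto
    qed
    then have "prob ?E \<le> prob ?H"
      by (intro finite_measure_mono H)
    also have "prob ?E = measure Q (- ?S) ^ n"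
      using S elim(2) by (intro prob_iid_all_in[OF indep law]) auto
    also have "measure Q (- ?S) = 1 - measure Q ?S"
      using Q.prob_compl[of ?S] S Q by (simp add: Compl_eq_Diff_UNIV)
    finally have "(1 - measure Q ?S) ^ n < 1 / 2"
      using elim by simp
    moreover have "1 + real n * (- measure Q ?S) \<le> (1 + - measure Q ?S) ^ n"
      using Q.prob_le_1[of ?S] by (intro Bernoulli_inequality) auto
    ultimately show ?case by simp
  qed
qed

section \<open>Finiteness, homogeneity and coercivity of the gauge\<close>

lemma gauge_function_le:
  "0 \<le> t \<Longrightarrow> z \<in> G \<Longrightarrow> gauge_function G (t *\<^sub>R z) \<le> ereal t"
  unfolding gauge_function_def by (rule Inf_lower) auto

lemma gauge_function_zero:
  assumes "G \<noteq> {}" shows "gauge_function G 0 = 0"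
proof (rule antisym)
  obtain z where "z \<in> G" using assms by auto
  then show "gauge_function G 0 \<le> 0"
    using gauge_function_le[of 0 z G] by (simp add: zero_ereal_def)
  show "0 \<le> gauge_function G 0"
    unfolding gauge_function_def by (rule Inf_greatest) auto
qed

text \<open>Every admissible \<open>t\<close> for \<open>s *\<^sub>R x\<close> yields the admissible
  \<open>t / s\<close> for \<open>x\<close>. The reverse inequality later comes from this one with
  factor \<open>1 / s\<close>.\<close>

lemma gauge_function_scale_le:
  assumes "0 < s"
  shows "ereal s * gauge_function G x \<le> gauge_function G (s *\<^sub>R x)"
  unfolding gauge_function_def[of G "s *\<^sub>R x"]
proof (rule Inf_greatest)
  fix u assume "u \<in> {ereal t |t. 0 \<le> t \<and> s *\<^sub>R x \<in> (\<lambda>z. t *\<^sub>R z) ` G}"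
  then obtain t z where t: "u = ereal t" "0 \<le> t" "z \<in> G" "s *\<^sub>R x = t *\<^sub>R z" by auto
  have "x = (1 / s) *\<^sub>R (s *\<^sub>R x)" using assms by simp
  then have "x = (t / s) *\<^sub>R z" by (simp add: t(4))
  then have "gauge_function G x \<le> ereal (t / s)"
    using gauge_function_le[of "t / s" z G] t assms by simp
  then have "ereal s * gauge_function G x \<le> ereal s * ereal (t / s)"
    using assms by (intro ereal_mult_left_mono) auto
  then show "ereal s * gauge_function G x \<le> u" using assms t(1) by simp
qed

text \<open>Boundedness of \<open>G\<close> makes the gauge positive away from the origin and
  coercive; the latter lets a minimum be attained on an unbounded region.\<close>

lemma gauge_function_ge_norm:
  assumes "\<And>z. z \<in> G \<Longrightarrow> norm z \<le> R" "0 < R"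
  shows "ereal (norm x / R) \<le> gauge_function G x"
  unfolding gauge_function_def
proof (rule Inf_greatest)
  fix u assume "u \<in> {ereal t |t. 0 \<le> t \<and> x \<in> (\<lambda>z. t *\<^sub>R z) ` G}"
  then obtain t z where t: "u = ereal t" "0 \<le> t" "z \<in> G" "x = t *\<^sub>R z" by auto
  have "norm x \<le> t * R" using t assms(1)[of z] by (simp add: mult_left_mono)
  then show "ereal (norm x / R) \<le> u" using t(1) assms(2) by (simp add: field_simps)
qed

lemma nonneg_orthant_scaleR: "x \<in> nonneg_orthant \<Longrightarrow> 0 \<le> s \<Longrightarrow> s *\<^sub>R x \<in> nonneg_orthant"
  by (simp add: nonneg_orthant_def)

text \<open>Continuity at the origin, where the gauge vanishes, together with homogeneity rules out
  infinite values.\<close>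

lemma continuous_gauge_real:
  fixes G :: "(real ^ 'd) set"
  assumes G: "compact G" "G \<noteq> {}" and cont: "continuous_on nonneg_orthant (gauge_function G)"
  obtains h R where "0 < R" "continuous_on nonneg_orthant h"
    "\<And>x. x \<in> nonneg_orthant \<Longrightarrow> gauge_function G x = ereal (h x)"
    "\<And>x s. x \<in> nonneg_orthant \<Longrightarrow> 0 < s \<Longrightarrow> h (s *\<^sub>R x) = s * h x"
    "\<And>x. x \<in> nonneg_orthant \<Longrightarrow> norm x / R \<le> h x"
proof -
  let ?g = "gauge_function G"
  obtain R where R: "0 < R" "\<And>z. z \<in> G \<Longrightarrow> norm z \<le> R"
    using compact_imp_bounded[OF G(1)] by (auto simp: bounded_pos)
  have ge: "ereal (norm x / R) \<le> ?g x" for x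
    using gauge_function_ge_norm[of G R x] R by auto
  have fin: "?g x < \<infinity>" if x: "x \<in> nonneg_orthant" for x
  proof -
    have "(?g \<longlongrightarrow> ?g 0) (at 0 within nonneg_orthant)"
      using cont by (auto simp: continuous_on_def nonneg_orthant_def)
    then have "\<forall>\<^sub>F y in at 0 within nonneg_orthant. ?g y < 1"
      by (rule order_tendstoD) (simp add: gauge_function_zero[OF G(2)])
    then obtain d where d: "d > 0"
      "\<And>y. y \<in> nonneg_orthant \<Longrightarrow> y \<noteq> 0 \<Longrightarrow> dist y 0 < d \<Longrightarrow> ?g y < 1"
      by (auto simp: eventually_at)
    show ?thesis
    proof (cases "x = 0")
      case False
      \<comment> \<open>The factor gives \<open>s *\<^sub>R x\<close> the norm \<open>d / 2\<close>,
        inside the neighbourhood of 0 where the gauge is below 1.\<close>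
      define s where "s = d / (2 * norm x)"
      have s: "0 < s" using d(1) False by (simp add: s_def)
      have "norm (s *\<^sub>R x) < d" using d(1) False by (simp add: s_def)
      then have "?g (s *\<^sub>R x) < 1"
        using d(2)[of "s *\<^sub>R x"] s False nonneg_orthant_scaleR[OF x, of s] by simp
      with gauge_function_scale_le[OF s, of G x] have "ereal s * ?g x < 1" by simp
      then show ?thesis using s by (cases "?g x") auto
    qed (simp add: gauge_function_zero[OF G(2)])
  qed
  define h where "h = (\<lambda>x. real_of_ereal (?g x))"
  have h: "?g x = ereal (h x)" if "x \<in> nonneg_orthant" for x
    using fin[OF that] ge[of x] unfolding h_def by (cases "?g x") auto
  have scale_le: "s * h x \<le> h (s *\<^sub>R x)" if "x \<in> nonneg_orthant" "0 < s" for x s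
    using gauge_function_scale_le[OF that(2), of G x] h[OF that(1)]
      h[OF nonneg_orthant_scaleR[OF that(1), of s]] that(2) by simp
  show ?thesis
  proof (rule that[of R h])
    show "continuous_on nonneg_orthant h"
    proof -
      have "continuous_on nonneg_orthant (\<lambda>x. ereal (h x))"
        using cont by (rule continuous_on_eq) (simp add: h)
      then show ?thesis by (simp add: continuous_on_def)
    qed
    show "h (s *\<^sub>R x) = s * h x" if "x \<in> nonneg_orthant" "0 < s" for x s
    proof (rule antisym)
      show "h (s *\<^sub>R x) \<le> s * h x"
        using scale_le[OF nonneg_orthant_scaleR[OF that(1), of s], of "1 / s"] that(2)
        by (simp add: field_simps)
    qed (rule scale_le[OF that])
    show "norm x / R \<le> h x" if "x \<in> nonneg_orthant" for x
      using ge[of x] h[OF that] by simp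
  qed (use R h in auto)
qed

section \<open>Minimising the gauge over the tail region\<close>

text \<open>Closed form of the joint tail event for \<open>x = y = 1\<close> after taking logarithms
  and dividing by \<open>ln t\<close>. It contains both \<open>B1 C \<delta>\<close> and
  \<open>B C \<delta>\<close>, so one minimiser over it lying in \<open>B1 C \<delta>\<close>
  settles both minima.\<close>

definition tail_region :: "'d set \<Rightarrow> real \<Rightarrow> (real ^ 'd) set" where
  "tail_region C \<delta> = {x \<in> nonneg_orthant. (\<forall>i\<in>C. 1 \<le> x $ i) \<and> (\<forall>j\<in>-C. x $ j \<le> \<delta>)}"

lemma B1_subset_B: "B1 C \<delta> \<subseteq> B C \<delta>"
  by (simp add: B_def)

lemma B_subset_tail_region: "B C \<delta> \<subseteq> tail_region C \<delta>"
  unfolding B_def B1_def Bdelta_def tail_region_def by force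

lemma nonneg_orthant_closed: "closed (nonneg_orthant :: (real ^ 'd) set)"
  unfolding nonneg_orthant_def
  by (intro closed_Collect_all closed_Collect_le continuous_intros)

lemma tail_region_closed: "closed (tail_region C \<delta>)"
proof -
  have "tail_region C \<delta> =
      nonneg_orthant \<inter> (\<Inter>i\<in>C. {x. 1 \<le> x $ i}) \<inter> (\<Inter>j\<in>-C. {x. x $ j \<le> \<delta>})"
    by (auto simp: tail_region_def)
  also have "closed \<dots>"
    by (intro closed_Int closed_INT ballI nonneg_orthant_closed closed_Collect_le continuous_intros)
  finally show ?thesis .
qed

text \<open>Dividing by the smallest coordinate over \<open>C\<close>, which is at least 1, turns
  that coordinate into 1 and keeps the others over \<open>C\<close> at least 1. The remaining
  coordinates only shrink and stay below \<open>\<delta>\<close>.\<close>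

lemma tail_region_scale_to_B1:
  fixes C :: "'d::finite set"
  assumes x: "x \<in> tail_region C \<delta>" and "C \<noteq> {}" "0 \<le> \<delta>"
  obtains s where "0 < s" "s \<le> 1" "s *\<^sub>R x \<in> B1 C \<delta>"
proof -
  define m where "m = Min ((\<lambda>i. x $ i) ` C)"
  have "m \<in> (\<lambda>i. x $ i) ` C"
    unfolding m_def using \<open>C \<noteq> {}\<close> by (intro Min_in) auto
  then obtain i where i: "i \<in> C" "m = x $ i" by auto
  have le: "m \<le> x $ j" if "j \<in> C" for j
    using that by (simp add: m_def)
  have m: "1 \<le> m" using x i by (auto simp: tail_region_def)
  have "(1 / m) *\<^sub>R x \<in> B1 C \<delta>"
    unfolding B1_def
  proof (intro UN_I[OF i(1)] CollectI conjI ballI)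
    show "(1 / m) *\<^sub>R x \<in> nonneg_orthant"
      using x m by (intro nonneg_orthant_scaleR) (auto simp: tail_region_def)
    show "((1 / m) *\<^sub>R x) $ i = 1" using i m by simp
    show "1 \<le> ((1 / m) *\<^sub>R x) $ j" if "j \<in> C - {i}" for j
      using le[of j] that m by (simp add: field_simps)
    show "((1 / m) *\<^sub>R x) $ k \<le> \<delta>" if "k \<in> UNIV - C" for k
    proof -
      have "x $ k \<le> \<delta>" using x that by (simp add: tail_region_def)
      also have "\<delta> \<le> \<delta> * m" using m \<open>0 \<le> \<delta>\<close> by (simp add: mult_le_cancel_left1)
      finally show ?thesis using m by (simp add: field_simps)
    qed
  qed
  then show ?thesis using that[of "1 / m"] m by simp
qed

text \<open>Outside the ball of radius \<open>R * h e\<close> the norm bound makes \<open>h\<close>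
  exceed \<open>h e\<close>, so a minimum exists on the compact part inside. Shrinking the minimiser
  into \<open>B1 C \<delta>\<close> cannot increase the positive homogeneous function
  \<open>h\<close>.\<close>

lemma homogeneous_min_on_B1:
  fixes h :: "real ^ 'd \<Rightarrow> real"
  assumes cont: "continuous_on nonneg_orthant h"
    and scale: "\<And>x s. x \<in> nonneg_orthant \<Longrightarrow> 0 < s \<Longrightarrow> h (s *\<^sub>R x) = s * h x"
    and ge: "\<And>x. x \<in> nonneg_orthant \<Longrightarrow> norm x / R \<le> h x" and "0 < R"
    and "C \<noteq> {}" "0 \<le> \<delta>"
  obtains y where "y \<in> B1 C \<delta>" "\<And>x. x \<in> tail_region C \<delta> \<Longrightarrow> h y \<le> h x" "0 < h y"
proof -
  let ?A = "tail_region C \<delta>"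
  define e :: "real ^ 'd" where "e = (\<chi> i. if i \<in> C then 1 else 0)"
  have e: "e \<in> ?A" using \<open>0 \<le> \<delta>\<close> by (auto simp: e_def tail_region_def nonneg_orthant_def)
  have sub: "?A \<subseteq> nonneg_orthant" by (auto simp: tail_region_def)
  let ?K = "?A \<inter> cball 0 (R * h e)"
  have eK: "e \<in> ?K" using e ge[of e] sub \<open>0 < R\<close> by (auto simp: field_simps)
  have "compact ?K" by (intro closed_Int_compact tail_region_closed compact_cball)
  moreover have "continuous_on ?K h" using cont by (rule continuous_on_subset) (use sub in auto)
  ultimately obtain y where y: "y \<in> ?K" "\<And>x. x \<in> ?K \<Longrightarrow> h y \<le> h x"
    using continuous_attains_inf[of ?K h] eK by blast
  have min: "h y \<le> h x" if x: "x \<in> ?A" for x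
  proof (cases "x \<in> ?K")
    case False
    then have "h e < norm x / R" using x \<open>0 < R\<close> by (auto simp: field_simps)
    also have "\<dots> \<le> h x" using x sub by (intro ge) auto
    finally show ?thesis using y(2)[OF eK] by simp
  qed (rule y)
  obtain s where s: "0 < s" "s \<le> 1" "s *\<^sub>R y \<in> B1 C \<delta>"
    using tail_region_scale_to_B1[of y C \<delta>] y(1) \<open>C \<noteq> {}\<close> \<open>0 \<le> \<delta>\<close> by auto
  have pos: "0 < h x" if x: "x \<in> ?A" for x
  proof -
    from x \<open>C \<noteq> {}\<close> have "x \<noteq> 0" by (auto simp: tail_region_def)
    then have "0 < norm x / R" using \<open>0 < R\<close> by simp
    also have "\<dots> \<le> h x" using x sub by (intro ge) auto
    finally show ?thesis .
  qed
  have "h (s *\<^sub>R y) = s * h y" using y(1) sub s(1) by (intro scale) auto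
  also have "\<dots> \<le> h y" using s pos[of y] y(1) by (simp add: mult_le_cancel_right1)
  finally have "h (s *\<^sub>R y) \<le> h x" if "x \<in> ?A" for x using min[OF that] by simp
  moreover have "s *\<^sub>R y \<in> ?A" using s(3) B1_subset_B B_subset_tail_region by blast
  ultimately show ?thesis using that[OF s(3)] pos by auto
qed

section \<open>The joint tail probability on the exponential scale\<close>

text \<open>The Pareto tail equals 1 at \<open>x = 1\<close>. Almost surely the logarithms below
  thus have positive arguments.\<close>

lemma (in prob_space) AE_standard_pareto:
  fixes Z :: "'a \<Rightarrow> real ^ 'd"
  assumes "\<And>i. standard_pareto M (\<lambda>\<omega>. Z \<omega> $ i)"
  shows "AE \<omega> in M. \<forall>i. 1 < Z \<omega> $ i"
proof -
  have "AE \<omega> in M. 1 < Z \<omega> $ i" for i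
  proof -
    have "prob {\<omega> \<in> space M. 1 < Z \<omega> $ i} = 1"
      using assms[of i] by (simp add: standard_pareto_def)
    from AE_prob_1[OF this] show ?thesis by simp
  qed
  then show ?thesis by (simp add: AE_all_countable)
qed

text \<open>Pareto variables exceed 1, so for \<open>\<delta> = 0\<close> and \<open>y < 1\<close> the joint tail probability vanishes
  unless the condition on the complement of \<open>C\<close> is void. Hence the region has interior points
  whenever the hypotheses of the theorem hold.\<close>

lemma (in prob_space) regularly_varying_joint_tail_prob_delta_0:
  fixes Z :: "'a \<Rightarrow> real ^ 'd"
  assumes pareto: "\<And>i. standard_pareto M (\<lambda>\<omega>. Z \<omega> $ i)"
    and rv: "regularly_varying (joint_tail_prob M Z C 0 1 (1 / 2)) \<rho>"
  shows "C = UNIV"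
proof (rule ccontr)
  assume "C \<noteq> UNIV"
  then obtain j where j: "j \<notin> C" by auto
  have zero: "joint_tail_prob M Z C 0 1 (1 / 2) t = 0" if "0 < t" for t
  proof -
    have "AE \<omega> in M. \<not> ((\<forall>i\<in>C. Z \<omega> $ i > 1 * t) \<and> (\<forall>j\<in>UNIV - C. Z \<omega> $ j \<le> 1 / 2 * t powr 0))"
      using AE_standard_pareto[OF pareto]
    proof eventually_elim
      case (elim \<omega>)
      then have "1 < Z \<omega> $ j" by simp
      then show ?case using j that by (auto intro!: bexI[of _ j])
    qed
    then show ?thesis
      unfolding joint_tail_prob_def by (rule prob_eq_0_AE)
  qed
  \<comment> \<open>Regular variation demands the limit \<open>1 powr \<rho> = 1\<close>, but the
    vanishing probabilities make the ratio \<open>0 / 0 = 0\<close>.\<close>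
  have "((\<lambda>t. joint_tail_prob M Z C 0 1 (1 / 2) (t * 1) / joint_tail_prob M Z C 0 1 (1 / 2) t)
      \<longlongrightarrow> 1 powr \<rho>) at_top"
    by (rule rv[unfolded regularly_varying_def, rule_format]) simp
  moreover have "((\<lambda>t. joint_tail_prob M Z C 0 1 (1 / 2) (t * 1) / joint_tail_prob M Z C 0 1 (1 / 2) t)
      \<longlongrightarrow> 0) at_top"
    by (rule tendsto_eventually) (use eventually_gt_at_top[of 0] in eventually_elim, simp add: zero)
  ultimately show False
    using tendsto_unique[OF trivial_limit_at_top_linorder] by fastforce
qed

text \<open>For \<open>t = n powr \<theta>\<close>, logarithms turn the thresholds \<open>t\<close>
  and \<open>t powr \<delta>\<close> into \<open>\<theta>\<close> and
  \<open>\<theta> * \<delta>\<close> times \<open>ln n\<close>, which is the scaling of the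
  cloud.\<close>

lemma joint_tail_event_iff:
  fixes z :: "real ^ 'd"
  assumes z: "\<And>i. 0 < z $ i" and "1 < n"
  shows "(\<forall>i\<in>C. z $ i > 1 * n powr \<theta>) \<and> (\<forall>j\<in>UNIV - C. z $ j \<le> 1 * (n powr \<theta>) powr \<delta>) \<longleftrightarrow>
    (\<forall>i\<in>C. \<theta> < ((1 / ln n) *\<^sub>R log_vec z) $ i) \<and>
    (\<forall>j\<in>UNIV - C. ((1 / ln n) *\<^sub>R log_vec z) $ j \<le> \<theta> * \<delta>)"
proof -
  have n: "0 < ln n" using \<open>1 < n\<close> by simp
  have "z $ i > 1 * n powr \<theta> \<longleftrightarrow> \<theta> < ((1 / ln n) *\<^sub>R log_vec z) $ i" for i
  proof -
    have "z $ i > 1 * n powr \<theta> \<longleftrightarrow> ln (n powr \<theta>) < ln (z $ i)"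
      using z[of i] \<open>1 < n\<close> by (subst ln_less_cancel_iff) auto
    then show ?thesis using n \<open>1 < n\<close> by (simp add: ln_powr log_vec_def field_simps)
  qed
  moreover have "z $ j \<le> 1 * (n powr \<theta>) powr \<delta> \<longleftrightarrow> ((1 / ln n) *\<^sub>R log_vec z) $ j \<le> \<theta> * \<delta>" for j
  proof -
    have "z $ j \<le> 1 * (n powr \<theta>) powr \<delta> \<longleftrightarrow> ln (z $ j) \<le> ln (n powr (\<theta> * \<delta>))"
      using z[of j] \<open>1 < n\<close> by (subst ln_le_cancel_iff) (auto simp: powr_powr)
    then show ?thesis using n \<open>1 < n\<close> by (simp add: ln_powr log_vec_def field_simps)
  qed
  ultimately show ?thesis by simp
qed

text \<open>The tail event mixes strict and weak inequalities. The two bounds allow it to be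
  enclosed in a closed set and to enclose an open one, as the two count estimates require.\<close>

lemma (in prob_space) joint_tail_prob_compare:
  fixes Z :: "'a \<Rightarrow> real ^ 'd"
  assumes Z[measurable]: "Z \<in> borel_measurable M"
    and pareto: "\<And>i. standard_pareto M (\<lambda>\<omega>. Z \<omega> $ i)"
    and "1 < n"
    and Q: "Q = distr M borel (\<lambda>\<omega>. log_vec (Z \<omega>))"
    and S[measurable]: "S \<in> sets borel"
  shows "(\<And>x. (\<forall>i\<in>C. \<theta> < x $ i) \<and> (\<forall>j\<in>UNIV - C. x $ j \<le> \<theta> * \<delta>) \<Longrightarrow> x \<in> S) \<Longrightarrow>
      joint_tail_prob M Z C \<delta> 1 1 (n powr \<theta>) \<le> measure Q {x. (1 / ln n) *\<^sub>R x \<in> S}"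
    and "(\<And>x. x \<in> S \<Longrightarrow> (\<forall>i\<in>C. \<theta> < x $ i) \<and> (\<forall>j\<in>UNIV - C. x $ j \<le> \<theta> * \<delta>)) \<Longrightarrow>
      measure Q {x. (1 / ln n) *\<^sub>R x \<in> S} \<le> joint_tail_prob M Z C \<delta> 1 1 (n powr \<theta>)"
proof -
  have log_vec[measurable]: "log_vec \<in> borel_measurable (borel :: (real ^ 'd) measure)"
    unfolding log_vec_def
    by (subst borel_measurable_euclidean_space) (auto simp: Basis_vec_def inner_axis)
  let ?E = "{\<omega> \<in> space M. (1 / ln n) *\<^sub>R log_vec (Z \<omega>) \<in> S}"
  let ?F = "{\<omega> \<in> space M. (\<forall>i\<in>C. Z \<omega> $ i > 1 * n powr \<theta>) \<and>
      (\<forall>j\<in>UNIV - C. Z \<omega> $ j \<le> 1 * (n powr \<theta>) powr \<delta>)}"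
  have E: "measure Q {x. (1 / ln n) *\<^sub>R x \<in> S} = prob ?E"
    unfolding Q by (subst measure_distr) (auto intro!: arg_cong[where f = prob])
  have F: "joint_tail_prob M Z C \<delta> 1 1 (n powr \<theta>) = prob ?F"
    by (simp only: joint_tail_prob_def)
  have "(\<lambda>\<omega>. (1 / ln n) *\<^sub>R log_vec (Z \<omega>)) \<in> borel_measurable M"
    by measurable
  then have "(\<lambda>\<omega>. (1 / ln n) *\<^sub>R log_vec (Z \<omega>)) -` S \<inter> space M \<in> events"
    using S by (rule measurable_sets)
  then have meas_E: "?E \<in> events"
    by (simp add: vimage_def Int_def conj_commute)
  have Z_comp: "(\<lambda>\<omega>. Z \<omega> $ i) \<in> borel_measurable M" for i
    using pareto by (simp add: standard_pareto_def)
  have meas_F: "?F \<in> events"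
    by (intro sets.sets_Collect_conj sets.sets_Collect_countable_Ball borel_measurable_less
        borel_measurable_le Z_comp borel_measurable_const countable_finite finite)
  have "AE \<omega> in M. \<omega> \<in> ?F \<longleftrightarrow> \<omega> \<in> space M \<and>
      (\<forall>i\<in>C. \<theta> < ((1 / ln n) *\<^sub>R log_vec (Z \<omega>)) $ i) \<and>
      (\<forall>j\<in>UNIV - C. ((1 / ln n) *\<^sub>R log_vec (Z \<omega>)) $ j \<le> \<theta> * \<delta>)"
    using AE_standard_pareto[OF pareto]
  proof eventually_elim
    case (elim \<omega>)
    then have "0 < Z \<omega> $ i" for i by (meson less_trans zero_less_one)
    from joint_tail_event_iff[OF this \<open>1 < n\<close>] show ?case by blast
  qed
  note iff = this
  {
    assume S: "\<And>x. (\<forall>i\<in>C. \<theta> < x $ i) \<and> (\<forall>j\<in>UNIV - C. x $ j \<le> \<theta> * \<delta>) \<Longrightarrow> x \<in> S"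
    have "AE \<omega> in M. \<omega> \<in> ?F \<longrightarrow> \<omega> \<in> ?E"
      using iff by eventually_elim (blast intro: S)
    then show "joint_tail_prob M Z C \<delta> 1 1 (n powr \<theta>) \<le> measure Q {x. (1 / ln n) *\<^sub>R x \<in> S}"
      unfolding E F by (intro finite_measure_mono_AE meas_E meas_F)
  next
    assume S: "\<And>x. x \<in> S \<Longrightarrow> (\<forall>i\<in>C. \<theta> < x $ i) \<and> (\<forall>j\<in>UNIV - C. x $ j \<le> \<theta> * \<delta>)"
    have "AE \<omega> in M. \<omega> \<in> ?E \<longrightarrow> \<omega> \<in> ?F"
      using iff by eventually_elim (use S in blast)
    then show "measure Q {x. (1 / ln n) *\<^sub>R x \<in> S} \<le> joint_tail_prob M Z C \<delta> 1 1 (n powr \<theta>)"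
      unfolding E F by (intro finite_measure_mono_AE meas_E meas_F)
  }
qed

section \<open>The tail index as the reciprocal of the minimal gauge\<close>

theorem proposition11:
  fixes M :: "'a measure"
    and X\<^sub>P :: "'a \<Rightarrow> real ^ 'd"
    and X :: "nat \<Rightarrow> 'a \<Rightarrow> real ^ 'd"
    and G :: "(real ^ 'd) set"
    and g :: "real ^ 'd \<Rightarrow> ereal"
    and C :: "'d set"
    and \<delta> \<tau> :: real
  assumes "prob_space M"
    and "X\<^sub>P \<in> borel_measurable M"
    and "\<And>i. standard_pareto M (\<lambda>\<omega>. X\<^sub>P \<omega> $ i)"
    and "prob_space.indep_vars M (\<lambda>_. borel) X UNIV"
    and "\<And>k. distr M borel (X k) = distr M borel (\<lambda>\<omega>. log_vec (X\<^sub>P \<omega>))"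
    and "converges_in_prob_onto M (sample_cloud X) G"
    and "g = gauge_function G"
    and "G = {x \<in> nonneg_orthant. g x \<le> 1}"
    and "continuous_on nonneg_orthant g"
    and "0 \<le> \<delta>" and "\<delta> \<le> 1"
    and "C \<noteq> {}"
    and "0 < \<tau>" and "\<tau> \<le> 1"
    and "\<And>x y. 0 < x \<Longrightarrow> 0 < y \<Longrightarrow> regularly_varying (joint_tail_prob M X\<^sub>P C \<delta> x y) (- 1 / \<tau>)"
  shows "(\<exists>y. is_arg_min g (\<lambda>y. y \<in> B C \<delta>) y \<and> ereal \<tau> = inverse (g y)) \<and>
         (\<exists>y. is_arg_min g (\<lambda>y. y \<in> B1 C \<delta>) y \<and> ereal \<tau> = inverse (g y))"
proof -
  interpret prob_space M by fact
  note X = assms(4) and law = assms(5) and conv = assms(6) and g = assms(7) and G_eq = assms(8)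
  define Q where "Q = distr M borel (\<lambda>\<omega>. log_vec (X\<^sub>P \<omega>))"
  have law: "distr M borel (X k) = Q" for k
    using law by (simp add: Q_def)
  have G: "compact G" "G \<noteq> {}"
    using conv by (auto simp: converges_in_prob_onto_def)
  obtain h R where R: "0 < R" and h_cont: "continuous_on nonneg_orthant h"
    and gh: "\<And>x. x \<in> nonneg_orthant \<Longrightarrow> g x = ereal (h x)"
    and h_scale: "\<And>x s. x \<in> nonneg_orthant \<Longrightarrow> 0 < s \<Longrightarrow> h (s *\<^sub>R x) = s * h x"
    and h_ge: "\<And>x. x \<in> nonneg_orthant \<Longrightarrow> norm x / R \<le> h x"
    using continuous_gauge_real[OF G] assms(9) unfolding g by metis
  obtain y where y: "y \<in> B1 C \<delta>" "\<And>x. x \<in> tail_region C \<delta> \<Longrightarrow> h y \<le> h x" "0 < h y"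
    using homogeneous_min_on_B1[OF h_cont h_scale h_ge R \<open>C \<noteq> {}\<close> \<open>0 \<le> \<delta>\<close>] by metis
  have y_tail: "y \<in> tail_region C \<delta>"
    using y(1) B1_subset_B B_subset_tail_region by blast
  have orthant: "x \<in> nonneg_orthant" if "x \<in> tail_region C \<delta>" for x
    using that by (simp add: tail_region_def)
  have in_G: "x \<in> G \<longleftrightarrow> x \<in> nonneg_orthant \<and> h x \<le> 1" for x
    using G_eq gh[of x] by auto
  define f where "f = joint_tail_prob M X\<^sub>P C \<delta> 1 1"
  have f_nonneg: "0 \<le> f t" for t
    by (simp add: f_def joint_tail_prob_def)
  \<comment> \<open>For \<open>n = 2 ^ m\<close> the expected count is
    \<open>n * f (n powr \<theta>)\<close>. Doubling \<open>n\<close> multiplies it asymptotically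
    by \<open>2 * (2 powr \<theta>) powr (- 1 / \<tau>)\<close>.\<close>
  have lim: "(\<lambda>m. (2 ^ Suc m * f ((2 powr \<theta>) ^ Suc m)) / (2 ^ m * f ((2 powr \<theta>) ^ m)))
      \<longlonglongrightarrow> 2 powr (1 - \<theta> / \<tau>)" if "0 < \<theta>" for \<theta>
  proof -
    have "2 * (2 powr \<theta>) powr (- 1 / \<tau>) = (2::real) powr (1 - \<theta> / \<tau>)"
      by (simp add: powr_powr powr_diff powr_minus field_simps)
    then show ?thesis
      using regularly_varying_geometric[OF assms(15)[of 1 1], of "2 powr \<theta>" 2] that
      by (simp add: f_def)
  qed
  have geom: "(2 powr \<theta>) ^ m = real (2 ^ m) powr \<theta>" for m \<theta>
    by (simp add: powr_powr mult.commute flip: powr_realpow)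
  have subseq: "filterlim (\<lambda>m. 2 ^ m :: nat) sequentially sequentially"
    by (intro filterlim_subseq strict_monoI) simp

  have upper: "\<tau> \<le> \<theta>" if \<theta>: "1 / h y < \<theta>" for \<theta>
  proof -
    have \<theta>_pos: "0 < \<theta>" using \<theta> y(3) by (meson divide_pos_pos less_trans zero_less_one)
    \<comment> \<open>Within the orthant this closed set is the tail region stretched by
      \<open>\<theta>\<close>. A point of \<open>G\<close> in it would shrink to a point of the tail
      region with gauge at most \<open>1 / \<theta> < h y\<close>.\<close>
    let ?K = "{x. (\<forall>i\<in>C. \<theta> \<le> x $ i) \<and> (\<forall>j\<in>UNIV - C. x $ j \<le> \<theta> * \<delta>)}"
    have K: "closed ?K"
      unfolding Collect_conj_eq Collect_ball_eq
      by (intro closed_Int closed_INT ballI closed_Collect_le continuous_intros)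
    have "?K \<inter> G = {}"
    proof (rule ccontr)
      assume "?K \<inter> G \<noteq> {}"
      then obtain x where x: "x \<in> ?K" "x \<in> nonneg_orthant" "h x \<le> 1" using in_G by auto
      have "(1 / \<theta>) *\<^sub>R x \<in> tail_region C \<delta>"
        using x \<theta>_pos by (auto simp: tail_region_def nonneg_orthant_def field_simps)
      then have "h y \<le> h ((1 / \<theta>) *\<^sub>R x)" by (rule y)
      also have "\<dots> = h x / \<theta>" using x \<theta>_pos by (simp add: h_scale)
      also have "\<dots> \<le> 1 / \<theta>" using x \<theta>_pos by (simp add: divide_right_mono)
      also have "\<dots> < h y" using \<theta> y(3) \<theta>_pos by (simp add: field_simps)
      finally show False by simp
    qed
    from sample_cloud_expected_count_le[OF X law conv K this]
    have "\<forall>\<^sub>F n in sequentially. real n * f (real n powr \<theta>) \<le> 1"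
      using eventually_gt_at_top[of 1]
    proof eventually_elim
      case (elim n)
      have "f (real n powr \<theta>) \<le> measure Q {x. (1 / ln (real n)) *\<^sub>R x \<in> ?K}"
        unfolding f_def
        by (rule joint_tail_prob_compare(1)[OF assms(2,3) _ Q_def])
          (use elim(2) K in \<open>auto intro: borel_closed less_imp_le\<close>)
      then have "real n * f (real n powr \<theta>) \<le> real n * measure Q {x. (1 / ln (real n)) *\<^sub>R x \<in> ?K}"
        by (intro mult_left_mono) auto
      with elim(1) show ?case by linarith
    qed
    then have "\<forall>\<^sub>F m in sequentially. real (2 ^ m) * f (real (2 ^ m) powr \<theta>) \<le> 1"
      by (rule eventually_compose_filterlim[OF _ subseq])
    then have "2 powr (1 - \<theta> / \<tau>) \<le> (1::real)"
      using f_nonneg by (intro ratio_limit_le_1[OF lim[OF \<theta>_pos], of 1]) (auto simp: geom)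
    then have "1 - \<theta> / \<tau> \<le> 0"
      by (metis not_le gr_one_powr one_less_numeral_iff semiring_norm(76))
    then show ?thesis using \<open>0 < \<tau>\<close> by (simp add: field_simps)
  qed

  have lower: "\<theta> \<le> \<tau>" if \<theta>: "0 < \<theta>" "\<theta> < 1 / h y" for \<theta>
  proof -
    \<comment> \<open>For \<open>\<delta> = 0\<close> the strict conditions off \<open>C\<close> in
      \<open>?U\<close> could not hold in the orthant; regular variation at \<open>y = 1 / 2\<close>
      excludes this case unless \<open>C\<close> is everything.\<close>
    have \<delta>: "0 < \<delta>" if "j \<notin> C" for j
      using regularly_varying_joint_tail_prob_delta_0[OF assms(3), of C "- 1 / \<tau>"]
        assms(15)[of 1 "1 / 2"] \<open>0 \<le> \<delta>\<close> that by (cases "\<delta> = 0") auto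
    let ?U = "{x. (\<forall>i\<in>C. \<theta> < x $ i) \<and> (\<forall>j\<in>UNIV - C. x $ j < \<theta> * \<delta>)}"
    have U: "open ?U"
      unfolding Collect_conj_eq Collect_ball_eq
      by (intro open_Int open_INT ballI finite open_Collect_less continuous_intros)
    \<comment> \<open>The point \<open>\<theta> *\<^sub>R y\<close> has gauge
      \<open>\<theta> * h y < 1\<close> but lies outside \<open>?U\<close>, since some coordinate of
      \<open>y\<close> over \<open>C\<close> is 1. Raising the coordinates over \<open>C\<close> and
      lowering the others moves it into \<open>?U\<close> along a path in the orthant, where
      continuity of \<open>h\<close> keeps the gauge below 1.\<close>
    define z where "z \<epsilon> = (\<chi> i. \<theta> * (if i \<in> C then 1 + \<epsilon> else 1 - \<epsilon>) * y $ i)" for \<epsilon> :: real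
    have z0: "z 0 = \<theta> *\<^sub>R y" by (simp add: z_def vec_eq_iff)
    have z_orthant: "z \<epsilon> \<in> nonneg_orthant" if "0 \<le> \<epsilon>" "\<epsilon> < 1" for \<epsilon>
      using that \<theta>(1) orthant[OF y_tail] by (auto simp: z_def nonneg_orthant_def)
    have z_U: "z \<epsilon> \<in> ?U" if \<epsilon>: "0 < \<epsilon>" "\<epsilon> < 1" for \<epsilon>
    proof (intro CollectI conjI ballI)
      fix i assume i: "i \<in> C"
      then have "1 \<le> y $ i" using y_tail by (simp add: tail_region_def)
      then have "1 + \<epsilon> \<le> (1 + \<epsilon>) * y $ i" using \<epsilon> by simp
      then have "1 < (1 + \<epsilon>) * y $ i" using \<epsilon> by linarith
      then show "\<theta> < z \<epsilon> $ i" using i \<theta>(1) by (simp add: z_def mult.assoc)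
    next
      fix j assume j: "j \<in> UNIV - C"
      then have "y $ j \<le> \<delta>" using y_tail by (simp add: tail_region_def)
      then have "(1 - \<epsilon>) * y $ j \<le> (1 - \<epsilon>) * \<delta>" using \<epsilon> by (intro mult_left_mono) auto
      also have "\<dots> < \<delta>" using \<epsilon> \<delta>[of j] j by simp
      finally show "z \<epsilon> $ j < \<theta> * \<delta>" using j \<theta>(1) by (simp add: z_def mult.assoc)
    qed
    have "continuous_on {0..<1} (h \<circ> z)"
    proof (rule continuous_on_compose)
      have "continuous_on {0..<1} (\<lambda>\<epsilon>. \<theta> * (if i \<in> C then 1 + \<epsilon> else 1 - \<epsilon>) * y $ i)" for i
        by (cases "i \<in> C") (auto intro!: continuous_intros)
      then show "continuous_on {0..<1} z"
        unfolding z_def by (rule continuous_on_vec_lambda)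
      show "continuous_on (z ` {0..<1}) h"
        using h_cont by (rule continuous_on_subset) (auto intro: z_orthant)
    qed
    then have "((h \<circ> z) \<longlongrightarrow> (h \<circ> z) 0) (at 0 within {0..<1})"
      unfolding continuous_on_def by (rule bspec) simp
    moreover have "(h \<circ> z) 0 < 1"
      using \<theta> y(3) h_scale[OF orthant[OF y_tail] \<theta>(1)] by (simp add: z0 field_simps)
    ultimately have "\<forall>\<^sub>F \<epsilon> in at 0 within {0..<1}. (h \<circ> z) \<epsilon> < 1"
      by (rule order_tendstoD)
    then obtain d where d: "0 < d" "\<And>\<epsilon>. 0 < \<epsilon> \<Longrightarrow> \<epsilon> < 1 \<Longrightarrow> \<epsilon> < d \<Longrightarrow> h (z \<epsilon>) < 1"
      by (auto simp: eventually_at)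
    define \<epsilon> where "\<epsilon> = min (1 / 2) (d / 2)"
    have \<epsilon>: "0 < \<epsilon>" "\<epsilon> < 1" "\<epsilon> < d" using d(1) by (auto simp: \<epsilon>_def)
    have "z \<epsilon> \<in> G" using in_G z_orthant[of \<epsilon>] d(2)[of \<epsilon>] \<epsilon> by simp
    from sample_cloud_expected_count_ge[OF X law conv U z_U[OF \<epsilon>(1,2)] this]
    have "\<forall>\<^sub>F n in sequentially. 1 / 2 \<le> real n * f (real n powr \<theta>)"
      using eventually_gt_at_top[of 1]
    proof eventually_elim
      case (elim n)
      have "measure Q {x. (1 / ln (real n)) *\<^sub>R x \<in> ?U} \<le> f (real n powr \<theta>)"
        unfolding f_def
        by (rule joint_tail_prob_compare(2)[OF assms(2,3) _ Q_def])
          (use elim(2) U in \<open>auto intro: borel_open less_imp_le\<close>)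
      then have "real n * measure Q {x. (1 / ln (real n)) *\<^sub>R x \<in> ?U} \<le> real n * f (real n powr \<theta>)"
        by (intro mult_left_mono) auto
      with elim(1) show ?case by linarith
    qed
    then have "\<forall>\<^sub>F m in sequentially. 1 / 2 \<le> real (2 ^ m) * f (real (2 ^ m) powr \<theta>)"
      by (rule eventually_compose_filterlim[OF _ subseq])
    then have "(1::real) \<le> 2 powr (1 - \<theta> / \<tau>)"
      by (intro ratio_limit_ge_1[OF lim[OF \<theta>(1)], of "1 / 2"]) (auto simp: geom)
    then have "0 \<le> 1 - \<theta> / \<tau>"
      using powr_less_mono[of "1 - \<theta> / \<tau>" 0 2] by (cases "0 \<le> 1 - \<theta> / \<tau>") auto
    then show ?thesis using \<open>0 < \<tau>\<close> by (simp add: field_simps)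
  qed

  have "\<tau> = 1 / h y"
  proof (rule antisym)
    show "\<tau> \<le> 1 / h y" by (rule dense_ge) (rule upper)
    show "1 / h y \<le> \<tau>"
      by (rule dense_le_bounded[of 0]) (use y(3) in \<open>auto intro: lower\<close>)
  qed
  then have "ereal \<tau> = inverse (g y)"
    using y(3) gh[OF orthant[OF y_tail]] by (simp add: inverse_eq_divide)
  \<comment> \<open>The same \<open>y\<close> serves both sets: it lies in each of them and
    minimises over the larger tail region.\<close>
  moreover have "is_arg_min g (\<lambda>y. y \<in> S) y" if "y \<in> S" "S \<subseteq> tail_region C \<delta>" for S
  proof -
    have "g y \<le> g x" if "x \<in> S" for x
    proof -
      from that \<open>S \<subseteq> tail_region C \<delta>\<close> have "x \<in> tail_region C \<delta>" by blast
      then show ?thesis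
        using y(2) gh[OF orthant] gh[OF orthant[OF y_tail]] by simp
    qed
    then show ?thesis
      using \<open>y \<in> S\<close> by (auto simp: is_arg_min_def not_less)
  qed
  moreover have "y \<in> B C \<delta>" "B1 C \<delta> \<subseteq> tail_region C \<delta>"
    using y(1) B1_subset_B B_subset_tail_region by blast+
  ultimately show ?thesis
    using y(1) B_subset_tail_region by blast
qed

end
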